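(* Let $\bm{\psi}:\mathbb{R}^n\to\mathbb{R}$ be a convex function, let $\mathbf{B}$ be a real $m\times n$ matrix of rank $r$ with $0<r\le\min\{m,n\}$ and singular value decomposition $\mathbf{B}=\mathbf{U}\mathbf{\Lambda}\mathbf{V}^\top$, and let $\mathbf{B}'=\mathbf{V}\mathbf{\Lambda}'\mathbf{U}'\in\mathbb{R}^{n\times(m+n-r)}$ be the associated matrix defined in the context. Let $\lambda>0$, $l\in\{0,1,\ldots,m\}$, and let $\mathbf{u}^*\in\mathbb{R}^n$ be such that $\mathbf{B}\mathbf{u}^*=\sum_{i\in\mathbb{N}_l}z^*_{k_i}\mathbf{e}_{k_i}$ with distinct $k_i\in\mathbb{N}_m$ and $z^*_{k_i}\in\mathbb{R}\setminus\{0\}$, $i\in\mathbb{N}_l$. Then the regularization problem $$\min\{\bm{\psi}(\mathbf{u})+\lambda\|\mathbf{B}\mathbf{u}\|_1:\mathbf{u}\in\mathbb{R}^n\}$$ has $\mathbf{u}^*$ as a solution if and only if there exist $\mathbf{a}\in\partial\bm{\psi}(\mathbf{u}^* )$ and $\mathbf{b}=[b_j:j\in\mathbb{N}_m]\in\mathcal{N}(\mathbf{B}^\top)$ such that $$\lambda=-\big((\mathbf{B}'_{k_i})^\top\mathbf{a}+b_{k_i}\big)\mathrm{sign}(z^*_{k_i}),\quad i\in\mathbb{N}_l,$$ $$\lambda\geq\big|(\mathbf{B}'_j)^\top\mathbf{a}+b_j\big|,\quad j\in\mathbb{N}_m\setminus\{k_i:i\in\mathbb{N}_l\},$$ $$(\mathbf{B}'_j)^\top\mathbf{a}=0,\quad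 j\in\mathbb{N}_{m+n-r}\setminus\mathbb{N}_m.$$
   Context: $\mathbb{N}_d:=\{1,\ldots,d\}$ and $\mathbb{N}_0:=\emptyset$; $\mathbf{e}_j$ is the $j$-th canonical basis vector of $\mathbb{R}^m$; $\mathbf{M}_j$ denotes the $j$-th column of a matrix $\mathbf{M}$; $\mathcal{N}(\cdot)$ is the null space; $\partial\bm{\psi}$ is the subdifferential. A solution of a minimization problem is a point at which the minimum is attained. Singular value decomposition: $\mathbf{U}$ is an $m\times m$ orthogonal matrix, $\mathbf{V}$ is an $n\times n$ orthogonal matrix, and $\mathbf{\Lambda}$ is the $m\times n$ diagonal matrix with diagonal entries $\sigma_1\geq\cdots\geq\sigma_r>0$ followed by zeros. Let $\widetilde{\mathbf{U}}_r\in\mathbb{R}^{m\times r}$ consist of the first $r$ columns of $\mathbf{U}$, let $\mathbf{\Lambda}':=\mathrm{diag}(\sigma_1^{-1},\ldots,\sigma_r^{-1},1,\ldots,1)\in\mathbb{R}^{n\times n}$, let $\mathbf{U}':=\mathrm{diag}(\widetilde{\mathbf{U}}_r^\top,\mathbf{I}_{n-r})$ be the $n\times(m+n-r)$ block diagonal matrix, and set $\mathbf{B}':=\mathbf{V}\mathbf{\Lambda}'\mathbf{U}'$. *)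

theory Defs
  imports
    Complex_Main
    "Jordan_Normal_Form.DL_Rank"
    "Jordan_Normal_Form.Matrix_Kernel"
begin

(* Vectors and matrices are those of Jordan_Normal_Form.Matrix, since the dimension m + n - r
   depends on the rank r.  R^n is carrier_vec n; all indices start at 0, so the index set
   {1,...,d} of the mathematical text corresponds to {..<d} here.  A function on R^n is given by
   a function on the type of all real vectors, of which only the values on carrier_vec n matter. *)

definition convex_fun_vec :: "nat \<Rightarrow> (real vec \<Rightarrow> real) \<Rightarrow> bool" where
  "convex_fun_vec n \<psi> \<longleftrightarrow>
    (\<forall>x \<in> carrier_vec n. \<forall>y \<in> carrier_vec n. \<forall>t. 0 \<le> t \<and> t \<le> 1 \<longrightarrow>
      \<psi> ((1 - t) \<cdot>\<^sub>v x + t \<cdot>\<^sub>v y) \<le> (1 - t) * \<psi> x + t * \<psi> y)"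

definition subdifferential_vec :: "nat \<Rightarrow> (real vec \<Rightarrow> real) \<Rightarrow> real vec \<Rightarrow> real vec set" where
  "subdifferential_vec n \<psi> x =
    {a \<in> carrier_vec n. \<forall>y \<in> carrier_vec n. \<psi> y \<ge> \<psi> x + a \<bullet> (y - x)}"

definition l1_norm_vec :: "real vec \<Rightarrow> real" where
  "l1_norm_vec x = (\<Sum>i<dim_vec x. \<bar>x $ i\<bar>)"

(* The library's orthogonal_mat only asks for pairwise orthogonal nonzero columns, not for
   columns of norm 1. *)
definition orthonormal_mat :: "nat \<Rightarrow> real mat \<Rightarrow> bool" where
  "orthonormal_mat n Q \<longleftrightarrow>
    Q \<in> carrier_mat n n \<and> transpose_mat Q * Q = 1\<^sub>m n \<and> Q * transpose_mat Q = 1\<^sub>m n"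

(* \<sigma> i is the (i+1)-st singular value; the values \<sigma> i for i \<ge> r are irrelevant. *)
definition singular_value_mat :: "nat \<Rightarrow> nat \<Rightarrow> nat \<Rightarrow> (nat \<Rightarrow> real) \<Rightarrow> real mat" where
  "singular_value_mat m n r \<sigma> = mat m n (\<lambda>(i, j). if i = j \<and> i < r then \<sigma> i else 0)"

definition is_svd ::
  "nat \<Rightarrow> nat \<Rightarrow> nat \<Rightarrow> real mat \<Rightarrow> real mat \<Rightarrow> (nat \<Rightarrow> real) \<Rightarrow> real mat \<Rightarrow> bool" where
  "is_svd m n r B U \<sigma> V \<longleftrightarrow>
    orthonormal_mat m U \<and> orthonormal_mat n V \<and>
    (\<forall>i<r. 0 < \<sigma> i) \<and> (\<forall>i j. i \<le> j \<and> j < r \<longrightarrow> \<sigma> j \<le> \<sigma> i) \<and>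
    B = U * singular_value_mat m n r \<sigma> * transpose_mat V"

definition Lambda' :: "nat \<Rightarrow> nat \<Rightarrow> (nat \<Rightarrow> real) \<Rightarrow> real mat" where
  "Lambda' n r \<sigma> = mat_diag n (\<lambda>i. if i < r then inverse (\<sigma> i) else 1)"

definition U' :: "nat \<Rightarrow> nat \<Rightarrow> nat \<Rightarrow> real mat \<Rightarrow> real mat" where
  "U' m n r U =
    diag_block_mat [transpose_mat (mat_of_cols m (take r (cols U))), 1\<^sub>m (n - r)]"

definition B' ::
  "nat \<Rightarrow> nat \<Rightarrow> nat \<Rightarrow> real mat \<Rightarrow> (nat \<Rightarrow> real) \<Rightarrow> real mat \<Rightarrow> real mat" where
  "B' m n r U \<sigma> V = V * Lambda' n r \<sigma> * U' m n r U"

lemma Lambda'_carrier: "Lambda' n r \<sigma> \<in> carrier_mat n n"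
  by (simp add: Lambda'_def)

lemma U'_carrier:
  assumes "U \<in> carrier_mat m m" "r \<le> m" "r \<le> n"
  shows "U' m n r U \<in> carrier_mat n (m + n - r)"
  using assms by (auto simp: U'_def Let_def intro!: carrier_matI)

lemma B'_carrier:
  assumes "U \<in> carrier_mat m m" "V \<in> carrier_mat n n" "r \<le> m" "r \<le> n"
  shows "B' m n r U \<sigma> V \<in> carrier_mat n (m + n - r)"
  unfolding B'_def
  using U'_carrier[OF assms(1,3,4)] Lambda'_carrier[of n r \<sigma>] assms(2) by (metis mult_carrier_mat)

end

theory Submission
  imports Defs
begin

text \<open>
  The optimal value of the perturbed problem, minimizing \<psi>(v) + \<lambda>|Bv + y|_1 over v, is convex in y, so
  it has a subgradient w at y = 0.  Testing that subgradient inequality with v = u and with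
  y = B(u - v) splits it into a subgradient inequality for the norm at Bu and one for \<psi> at u; thus u
  is a minimizer iff some g = -w satisfies B^T g \<in> \<partial>\<psi>(u) and -g \<in> \<lambda>\<partial>|.|_1(Bu).  The first m columns of
  B' form the pseudoinverse of B and the remaining ones span the null space of B.  Hence a has the
  form B^T g iff it is orthogonal to the latter, and then the solutions g are exactly the sums
  of (B'_j \<bullet> a)_j with elements b of the null space of B^T.
\<close>

section \<open>A Hahn-Banach type extension argument\<close>

text \<open>
  A convex relation stands in for the epigraph of an infimum, which therefore need not be attained.
  The slope w is built one coordinate at a time, as in the Hahn-Banach theorem.
\<close>
lemma convex_relation_affine_minorant:
  fixes Q :: "real vec \<Rightarrow> real \<Rightarrow> bool"
  assumes conv: "\<And>x y s t \<alpha>. \<lbrakk>x \<in> carrier_vec m; y \<in> carrier_vec m; Q x s; Q y t; 0 \<le> \<alpha>; \<alpha> \<le> 1\<rbrakk>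
      \<Longrightarrow> Q ((1 - \<alpha>) \<cdot>\<^sub>v x + \<alpha> \<cdot>\<^sub>v y) ((1 - \<alpha>) * s + \<alpha> * t)"
    and total: "\<And>x. x \<in> carrier_vec m \<Longrightarrow> \<exists>s. Q x s"
    and zero: "\<And>s. Q (0\<^sub>v m) s \<Longrightarrow> p \<le> s"
  shows "\<exists>w \<in> carrier_vec m. \<forall>x \<in> carrier_vec m. \<forall>s. Q x s \<longrightarrow> p + w \<bullet> x \<le> s"
proof -
  \<comment> \<open>Induction on \<open>d\<close>: the slope \<open>w\<close> need only work on
    vectors supported on the first \<open>d\<close> coordinates. For \<open>d = 0\<close> only the
    zero vector remains, where \<open>zero\<close> applies.\<close>
  have "\<exists>w \<in> carrier_vec m. \<forall>x \<in> carrier_vec m. (\<forall>i<m. d \<le> i \<longrightarrow> x $ i = 0) \<longrightarrow>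
      (\<forall>s. Q x s \<longrightarrow> p + w \<bullet> x \<le> s)" if "d \<le> m" for d
    using that
  proof (induction d)
    case 0
    have "x = 0\<^sub>v m" if "x \<in> carrier_vec m" "\<forall>i<m. x $ i = 0" for x :: "real vec"
      using that by auto
    then show ?case
      using zero by (metis add.right_neutral scalar_prod_left_zero zero_carrier_vec le0)
  next
    case (Suc d)
    define E where "E = {x \<in> carrier_vec m. \<forall>i<m. Suc d \<le> i \<longrightarrow> x $ i = (0::real)}"
    have d: "d < m" using Suc.prems by simp
    obtain w where w: "w \<in> carrier_vec m"
      and w_le: "\<And>x s. \<lbrakk>x \<in> carrier_vec m; \<forall>i<m. d \<le> i \<longrightarrow> x $ i = 0; Q x s\<rbrakk> \<Longrightarrow> p + w \<bullet> x \<le> s"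
      using Suc.IH d by (metis less_imp_le)
    have E_w_le: "p + w \<bullet> x \<le> s" if "x \<in> E" "x $ d = 0" "Q x s" for x s
      using that by (intro w_le) (auto simp: E_def Suc_le_eq le_less)
    \<comment> \<open>Adding \<open>c\<close> times the new basis vector to \<open>w\<close>
      requires \<open>p + w \<bullet> x + c * x $ d \<le> s\<close>. Solved for \<open>c\<close>,
      vectors with \<open>x $ d < 0\<close> give lower bounds, collected in \<open>L\<close>; those
      with \<open>x $ d > 0\<close> give the upper bounds in \<open>L_le\<close>.\<close>
    define L where "L = {(p + w \<bullet> x - s) / (- x $ d) |x s. x \<in> E \<and> x $ d < 0 \<and> Q x s}"
    have L_le: "a \<le> (s - p - w \<bullet> x) / x $ d"
      if a: "a \<in> L" and x: "x \<in> E" "0 < x $ d" "Q x s" for a x s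
    proof -
      obtain y r where y: "y \<in> E" "y $ d < 0" "Q y r" and a': "a = (p + w \<bullet> y - r) / (- y $ d)"
        using a by (auto simp: L_def)
      \<comment> \<open>The weight makes the \<open>d\<close>-th coordinates of \<open>y\<close> and
        \<open>x\<close> cancel in \<open>v\<close>, so the induction hypothesis applies to
        \<open>v\<close>.\<close>
      define \<alpha> where "\<alpha> = - y $ d / (x $ d - y $ d)"
      define v where "v = (1 - \<alpha>) \<cdot>\<^sub>v y + \<alpha> \<cdot>\<^sub>v x"
      have \<alpha>: "0 \<le> \<alpha>" "\<alpha> \<le> 1" "(1 - \<alpha>) * (x $ d - y $ d) = x $ d" "\<alpha> * (x $ d - y $ d) = - y $ d"
        using x(2) y(2) by (auto simp: \<alpha>_def field_simps)
      have xy: "x \<in> carrier_vec m" "y \<in> carrier_vec m"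
        using x(1) y(1) by (auto simp: E_def)
      have "(1 - \<alpha>) * y $ d + \<alpha> * x $ d = 0"
        using x(2) y(2) by (simp add: \<alpha>_def field_simps)
      then have "v \<in> E" "v $ d = 0"
        using x(1) y(1) d by (auto simp: v_def E_def)
      moreover have "Q v ((1 - \<alpha>) * r + \<alpha> * s)"
        unfolding v_def using xy x(3) y(3) \<alpha>(1,2) by (intro conv)
      ultimately have "p + w \<bullet> v \<le> (1 - \<alpha>) * r + \<alpha> * s"
        by (rule E_w_le)
      moreover have "w \<bullet> v = (1 - \<alpha>) * (w \<bullet> y) + \<alpha> * (w \<bullet> x)"
        using w xy by (simp add: v_def scalar_prod_add_distrib[of _ m])
      ultimately have "0 \<le> (1 - \<alpha>) * (r - p - w \<bullet> y) + \<alpha> * (s - p - w \<bullet> x)"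
        by (simp add: algebra_simps)
      \<comment> \<open>Multiplying by the positive number \<open>x $ d - y $ d\<close> clears the
        denominator of \<alpha>.\<close>
      then have "0 \<le> ((1 - \<alpha>) * (r - p - w \<bullet> y) + \<alpha> * (s - p - w \<bullet> x)) * (x $ d - y $ d)"
        using x(2) y(2) by simp
      also have "\<dots> = ((1 - \<alpha>) * (x $ d - y $ d)) * (r - p - w \<bullet> y)
          + (\<alpha> * (x $ d - y $ d)) * (s - p - w \<bullet> x)"
        by (simp add: algebra_simps)
      finally have "0 \<le> x $ d * (r - p - w \<bullet> y) - y $ d * (s - p - w \<bullet> x)"
        unfolding \<alpha> by simp
      then show ?thesis
        unfolding a' using x(2) y(2) by (simp add: divide_simps) (simp add: algebra_simps)
    qed
    \<comment> \<open>\<open>- e\<close> yields an element of \<open>L\<close> and \<open>e\<close>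
      an upper bound for it, so \<open>Sup L\<close> is a genuine supremum that respects both kinds
      of bounds.\<close>
    define e :: "real vec" where "e = unit_vec m d"
    have e: "e \<in> E" "- e \<in> E" "e $ d = 1" "(- e) $ d = -1"
      using d by (auto simp: e_def E_def)
    then obtain s1 s2 where "Q e s1" "Q (- e) s2"
      using total by (force simp: E_def)
    then have L: "L \<noteq> {}" "bdd_above L"
      using e L_le[of _ e s1] by (auto simp: L_def bdd_above_def intro!: exI[of _ "-e"])
    define w' where "w' = w + Sup L \<cdot>\<^sub>v e"
    have w': "w' \<in> carrier_vec m" using w by (simp add: w'_def e_def)
    have "p + w' \<bullet> x \<le> s" if x: "x \<in> E" and Q: "Q x s" for x s
    proof -
      have "w' \<bullet> x = w \<bullet> x + Sup L * x $ d"
        using w x d by (simp add: w'_def e_def E_def add_scalar_prod_distrib[of _ m]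
          smult_scalar_prod_distrib[of _ m])
      moreover consider "x $ d = 0" | "0 < x $ d" | "x $ d < 0" by linarith
      then have "p + w \<bullet> x + Sup L * x $ d \<le> s"
      proof cases
        case 1
        then show ?thesis using E_w_le x Q by simp
      next
        case 2
        then have "Sup L \<le> (s - p - w \<bullet> x) / x $ d"
          using L L_le x Q by (intro cSup_least)
        with 2 show ?thesis by (simp add: field_simps)
      next
        case 3
        then have "(p + w \<bullet> x - s) / (- x $ d) \<le> Sup L"
          using L x Q by (intro cSup_upper) (auto simp: L_def)
        with 3 show ?thesis by (simp add: field_simps)
      qed
      ultimately show ?thesis by simp
    qed
    then show ?case using w' by (auto simp: E_def)
  qed
  from this[of m] show ?thesis by auto
qed

section \<open>Convexity and subgradients of the l1 norm\<close>

lemma l1_norm_vec_convex: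
  assumes "x \<in> carrier_vec m" "y \<in> carrier_vec m" "0 \<le> \<alpha>" "\<alpha> \<le> 1"
  shows "l1_norm_vec ((1 - \<alpha>) \<cdot>\<^sub>v x + \<alpha> \<cdot>\<^sub>v y) \<le> (1 - \<alpha>) * l1_norm_vec x + \<alpha> * l1_norm_vec y"
proof -
  have "\<bar>(1 - \<alpha>) * a + \<alpha> * b\<bar> \<le> (1 - \<alpha>) * \<bar>a\<bar> + \<alpha> * \<bar>b\<bar>" for a b :: real
    using assms(3,4) abs_triangle_ineq[of "(1 - \<alpha>) * a" "\<alpha> * b"] by (simp add: abs_mult)
  then have "(\<Sum>i<m. \<bar>(1 - \<alpha>) * x $ i + \<alpha> * y $ i\<bar>) \<le> (\<Sum>i<m. (1 - \<alpha>) * \<bar>x $ i\<bar> + \<alpha> * \<bar>y $ i\<bar>)"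
    by (intro sum_mono)
  then show ?thesis
    using assms(1,2) by (simp add: l1_norm_vec_def sum.distrib sum_distrib_left)
qed

text \<open>The norm is a sum over coordinates, so the inequality decouples: \<open>- g $ j\<close>
  must be a subgradient of \<open>lam * \<bar>t\<bar>\<close> at \<open>t = x $ j\<close>. This is
  \<open>lam\<close> times the sign where \<open>x $ j \<noteq> 0\<close>, and any number in
  \<open>[-lam, lam]\<close> otherwise.\<close>

lemma l1_norm_vec_subgradient_iff:
  assumes x: "x \<in> carrier_vec m" and g: "g \<in> carrier_vec m" and "0 \<le> lam"
  shows "(\<forall>y \<in> carrier_vec m. lam * l1_norm_vec x - g \<bullet> (y - x) \<le> lam * l1_norm_vec y) \<longleftrightarrow>
    (\<forall>j<m. x $ j \<noteq> 0 \<longrightarrow> lam = - g $ j * sgn (x $ j)) \<and>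
    (\<forall>j<m. x $ j = 0 \<longrightarrow> \<bar>g $ j\<bar> \<le> lam)" (is "?L \<longleftrightarrow> ?R")
proof
  assume L: ?L
  \<comment> \<open>The scalar inequality comes from a test vector that differs from
    \<open>x\<close> in coordinate \<open>j\<close> only.\<close>
  have coord: "lam * \<bar>x $ j\<bar> - g $ j * (t - x $ j) \<le> lam * \<bar>t\<bar>" if j: "j < m" for j t
  proof -
    define y where "y = vec m (\<lambda>i. if i = j then t else x $ i)"
    have "lam * (l1_norm_vec y - l1_norm_vec x) + g \<bullet> (y - x) =
      (\<Sum>i<m. lam * (\<bar>y $ i\<bar> - \<bar>x $ i\<bar>) + g $ i * (y $ i - x $ i))"
      using x by (simp add: y_def l1_norm_vec_def scalar_prod_def lessThan_atLeast0
        sum_subtractf[symmetric] sum_distrib_left sum.distrib)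
    also have "\<dots> = (\<Sum>i\<in>{j}. lam * (\<bar>y $ i\<bar> - \<bar>x $ i\<bar>) + g $ i * (y $ i - x $ i))"
      using j by (intro sum.mono_neutral_right) (auto simp: y_def)
    finally show ?thesis
      using L[rule_format, of y] j by (simp add: y_def algebra_simps)
  qed
  show ?R
  proof (intro conjI allI impI)
    fix j assume j: "j < m" "x $ j \<noteq> 0"
    \<comment> \<open>The points \<open>0\<close> and \<open>2 * x $ j\<close> lie on either side of
      \<open>x $ j\<close> on a ray where the absolute value is linear; together they force
      equality.\<close>
    have "lam * \<bar>x $ j\<bar> + g $ j * x $ j \<le> 0" "0 \<le> lam * \<bar>x $ j\<bar> + g $ j * x $ j"
      using coord[OF j(1), of 0] coord[OF j(1), of "2 * x $ j"] by (auto simp: abs_mult algebra_simps)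
    then have "(lam * sgn (x $ j) + g $ j) * x $ j = 0"
      by (simp add: abs_sgn algebra_simps)
    then have "g $ j = - lam * sgn (x $ j)" using j(2) by simp
    then show "lam = - g $ j * sgn (x $ j)"
      using j(2) by (simp add: sgn_if)
  next
    fix j assume j: "j < m" "x $ j = 0"
    show "\<bar>g $ j\<bar> \<le> lam"
      using coord[OF j(1), of 1] coord[OF j(1), of "-1"] j(2) by auto
  qed
next
  assume R: ?R
  show ?L
  proof
    fix y :: "real vec" assume y: "y \<in> carrier_vec m"
    have "lam * \<bar>x $ j\<bar> - g $ j * (y $ j - x $ j) \<le> lam * \<bar>y $ j\<bar>" if j: "j < m" for j
    proof (cases "x $ j = 0")
      case True
      then have "\<bar>g $ j\<bar> * \<bar>y $ j\<bar> \<le> lam * \<bar>y $ j\<bar>"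
        using R j by (intro mult_right_mono) auto
      then show ?thesis
        using True abs_ge_minus_self[of "g $ j * y $ j"] by (simp add: abs_mult)
    next
      case False
      then have lam: "lam = - g $ j * sgn (x $ j)" using R j by blast
      then have "\<bar>g $ j\<bar> = lam"
        using False \<open>0 \<le> lam\<close> by (auto simp: sgn_if split: if_splits)
      then have "- (g $ j * y $ j) \<le> lam * \<bar>y $ j\<bar>"
        using abs_ge_minus_self[of "g $ j * y $ j"] by (simp add: abs_mult)
      moreover have "lam * \<bar>x $ j\<bar> = - g $ j * x $ j"
        using False by (subst lam) (auto simp: sgn_if)
      ultimately show ?thesis by (simp add: algebra_simps)
    qed
    then have "(\<Sum>j<m. lam * \<bar>x $ j\<bar> - g $ j * (y $ j - x $ j)) \<le> (\<Sum>j<m. lam * \<bar>y $ j\<bar>)"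
      by (intro sum_mono) auto
    then show "lam * l1_norm_vec x - g \<bullet> (y - x) \<le> lam * l1_norm_vec y"
      using x y by (simp add: l1_norm_vec_def scalar_prod_def lessThan_atLeast0
        sum_subtractf sum_distrib_left)
  qed
qed

section \<open>Optimality condition for the composite objective\<close>

text \<open>Fermat's rule together with the sum and chain rules. The objective is finite for every
  perturbation \<open>y\<close> of the norm's argument, so the slope of the value function at
  \<open>0\<close> exists and supplies the multiplier \<open>g\<close>.\<close>

lemma arg_min_l1_composite_iff:
  assumes \<psi>: "convex_fun_vec n \<psi>" and B: "B \<in> carrier_mat m n" and u: "u \<in> carrier_vec n"
    and lam: "0 \<le> lam"
  shows "is_arg_min (\<lambda>v. \<psi> v + lam * l1_norm_vec (B *\<^sub>v v)) (\<lambda>v. v \<in> carrier_vec n) u \<longleftrightarrow>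
    (\<exists>g \<in> carrier_vec m. transpose_mat B *\<^sub>v g \<in> subdifferential_vec n \<psi> u \<and>
      (\<forall>y \<in> carrier_vec m. lam * l1_norm_vec (B *\<^sub>v u) - g \<bullet> (y - B *\<^sub>v u) \<le> lam * l1_norm_vec y))"
    (is "is_arg_min ?f _ u \<longleftrightarrow> ?R")
proof
  assume min: "is_arg_min ?f (\<lambda>v. v \<in> carrier_vec n) u"
  \<comment> \<open>The projection to \<open>(y, s)\<close> of the epigraph of a function jointly
    convex in \<open>(v, y)\<close>, hence a convex relation. Minimality of \<open>u\<close> is
    exactly what bounds it below at \<open>y = 0\<close>.\<close>
  define Q where "Q y s \<longleftrightarrow> (\<exists>v \<in> carrier_vec n. \<psi> v + lam * l1_norm_vec (B *\<^sub>v v + y) \<le> s)" for y s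
  have Bv: "B *\<^sub>v v \<in> carrier_vec m" if "v \<in> carrier_vec n" for v
    using B that by simp
  have "\<exists>w \<in> carrier_vec m. \<forall>x \<in> carrier_vec m. \<forall>s. Q x s \<longrightarrow> ?f u + w \<bullet> x \<le> s"
  proof (rule convex_relation_affine_minorant)
    fix x y :: "real vec" and s t \<alpha> :: real
    assume xy: "x \<in> carrier_vec m" "y \<in> carrier_vec m" and Q: "Q x s" "Q y t"
      and \<alpha>: "0 \<le> \<alpha>" "\<alpha> \<le> 1"
    from Q obtain v v' where v: "v \<in> carrier_vec n" "\<psi> v + lam * l1_norm_vec (B *\<^sub>v v + x) \<le> s"
      and v': "v' \<in> carrier_vec n" "\<psi> v' + lam * l1_norm_vec (B *\<^sub>v v' + y) \<le> t"
      by (auto simp: Q_def)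
    define v'' where "v'' = (1 - \<alpha>) \<cdot>\<^sub>v v + \<alpha> \<cdot>\<^sub>v v'"
    have "B *\<^sub>v v'' = (1 - \<alpha>) \<cdot>\<^sub>v (B *\<^sub>v v) + \<alpha> \<cdot>\<^sub>v (B *\<^sub>v v')"
      using B v(1) v'(1) by (simp add: v''_def mult_add_distrib_mat_vec mult_mat_vec)
    then have "B *\<^sub>v v'' + ((1 - \<alpha>) \<cdot>\<^sub>v x + \<alpha> \<cdot>\<^sub>v y) =
      (1 - \<alpha>) \<cdot>\<^sub>v (B *\<^sub>v v + x) + \<alpha> \<cdot>\<^sub>v (B *\<^sub>v v' + y)"
      using B Bv[OF v(1)] Bv[OF v'(1)] xy
      by (intro eq_vecI) (auto simp: algebra_simps simp del: index_mult_mat_vec)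
    then have "l1_norm_vec (B *\<^sub>v v'' + ((1 - \<alpha>) \<cdot>\<^sub>v x + \<alpha> \<cdot>\<^sub>v y))
        \<le> (1 - \<alpha>) * l1_norm_vec (B *\<^sub>v v + x) + \<alpha> * l1_norm_vec (B *\<^sub>v v' + y)"
      using l1_norm_vec_convex[of "B *\<^sub>v v + x" m "B *\<^sub>v v' + y" \<alpha>] Bv v(1) v'(1) xy \<alpha> by simp
    then have "lam * l1_norm_vec (B *\<^sub>v v'' + ((1 - \<alpha>) \<cdot>\<^sub>v x + \<alpha> \<cdot>\<^sub>v y))
        \<le> lam * ((1 - \<alpha>) * l1_norm_vec (B *\<^sub>v v + x) + \<alpha> * l1_norm_vec (B *\<^sub>v v' + y))"
      using lam by (rule mult_left_mono)
    moreover have "\<psi> v'' \<le> (1 - \<alpha>) * \<psi> v + \<alpha> * \<psi> v'"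
      using \<psi> v(1) v'(1) \<alpha> by (simp add: convex_fun_vec_def v''_def)
    moreover have "(1 - \<alpha>) * (\<psi> v + lam * l1_norm_vec (B *\<^sub>v v + x)) \<le> (1 - \<alpha>) * s"
      "\<alpha> * (\<psi> v' + lam * l1_norm_vec (B *\<^sub>v v' + y)) \<le> \<alpha> * t"
      using v(2) v'(2) \<alpha> by (auto intro!: mult_left_mono)
    ultimately have "\<psi> v'' + lam * l1_norm_vec (B *\<^sub>v v'' + ((1 - \<alpha>) \<cdot>\<^sub>v x + \<alpha> \<cdot>\<^sub>v y))
        \<le> (1 - \<alpha>) * s + \<alpha> * t"
      by (simp add: algebra_simps)
    then show "Q ((1 - \<alpha>) \<cdot>\<^sub>v x + \<alpha> \<cdot>\<^sub>v y) ((1 - \<alpha>) * s + \<alpha> * t)"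
      unfolding Q_def using v(1) v'(1) by (intro bexI[of _ v'']) (auto simp: v''_def)
  next
    show "\<exists>s. Q x s" for x
      using u by (auto simp: Q_def)
  next
    fix s assume "Q (0\<^sub>v m) s"
    then obtain v where v: "v \<in> carrier_vec n" "\<psi> v + lam * l1_norm_vec (B *\<^sub>v v + 0\<^sub>v m) \<le> s"
      by (auto simp: Q_def)
    moreover have "B *\<^sub>v v + 0\<^sub>v m = B *\<^sub>v v"
      using Bv[OF v(1)] by simp
    moreover have "?f u \<le> ?f v"
      using min v(1) by (auto simp: is_arg_min_def not_less)
    ultimately show "?f u \<le> s" by simp
  qed
  then obtain w where w: "w \<in> carrier_vec m"
    and w_le: "\<And>x s. x \<in> carrier_vec m \<Longrightarrow> Q x s \<Longrightarrow> ?f u + w \<bullet> x \<le> s"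
    by blast
  \<comment> \<open>The perturbation \<open>y - B *\<^sub>v v\<close> turns the argument of the norm
    into \<open>y\<close>, so that \<open>v\<close> and \<open>y\<close> vary independently.\<close>
  have key: "?f u + w \<bullet> (y - B *\<^sub>v v) \<le> \<psi> v + lam * l1_norm_vec y"
    if "v \<in> carrier_vec n" "y \<in> carrier_vec m" for v y
  proof -
    have "B *\<^sub>v v + (y - B *\<^sub>v v) = y"
      using B Bv[OF that(1)] that(2) by (intro eq_vecI) (auto simp del: index_mult_mat_vec)
    then show ?thesis
      using Bv[OF that(1)] that by (intro w_le) (auto simp: Q_def intro!: bexI[of _ v])
  qed
  \<comment> \<open>Taking \<open>y = B *\<^sub>v u\<close> cancels the norm terms; below,
    \<open>v = u\<close> cancels the values of \<psi> instead. The witness is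
    \<open>g = - w\<close>.\<close>
  have "\<psi> u + (transpose_mat B *\<^sub>v (- w)) \<bullet> (v - u) \<le> \<psi> v" if v: "v \<in> carrier_vec n" for v
  proof -
    have "(transpose_mat B *\<^sub>v (- w)) \<bullet> (v - u) = (- w) \<bullet> (B *\<^sub>v v - B *\<^sub>v u)"
      using B w v u by (simp add: transpose_vec_mult_scalar[OF B] mult_minus_distrib_mat_vec)
    also have "\<dots> = w \<bullet> (B *\<^sub>v u - B *\<^sub>v v)"
      using B Bv[OF u] Bv[OF v] w by (simp add: scalar_prod_minus_distrib)
    finally show ?thesis
      using key[OF v Bv[OF u]] by simp
  qed
  moreover have "transpose_mat B *\<^sub>v (- w) \<in> carrier_vec n"
    using B w by simp
  moreover have "lam * l1_norm_vec (B *\<^sub>v u) - (- w) \<bullet> (y - B *\<^sub>v u) \<le> lam * l1_norm_vec y"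
    if "y \<in> carrier_vec m" for y
    using key[OF u that] B w that by simp
  ultimately show ?R
    using w by (intro bexI[of _ "- w"]) (auto simp: subdifferential_vec_def)
next
  assume ?R
  then obtain g where g: "g \<in> carrier_vec m" "transpose_mat B *\<^sub>v g \<in> subdifferential_vec n \<psi> u"
    "\<And>y. y \<in> carrier_vec m \<Longrightarrow> lam * l1_norm_vec (B *\<^sub>v u) - g \<bullet> (y - B *\<^sub>v u) \<le> lam * l1_norm_vec y"
    by blast
  \<comment> \<open>With \<open>y = B *\<^sub>v v\<close> the two subgradient inequalities have
    opposite linear terms, and adding them gives the claim.\<close>
  have "?f u \<le> ?f v" if v: "v \<in> carrier_vec n" for v
  proof -
    have "(transpose_mat B *\<^sub>v g) \<bullet> (v - u) = g \<bullet> (B *\<^sub>v v - B *\<^sub>v u)"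
      using B g(1) v u by (simp add: transpose_vec_mult_scalar[OF B] mult_minus_distrib_mat_vec)
    moreover have "\<psi> u + (transpose_mat B *\<^sub>v g) \<bullet> (v - u) \<le> \<psi> v"
      using g(2) v by (simp add: subdifferential_vec_def)
    ultimately show ?thesis
      using g(3)[of "B *\<^sub>v v"] B v by simp
  qed
  then show "is_arg_min ?f (\<lambda>v. v \<in> carrier_vec n) u"
    using u by (auto simp: is_arg_min_def not_less)
qed

section \<open>The columns of \<open>B'\<close> in terms of the singular value decomposition\<close>

lemma index_U':
  assumes "U \<in> carrier_mat m m" "r \<le> m" "r \<le> n" "i < n" "j < m + n - r"
  shows "U' m n r U $$ (i, j) =
    (if i < r then if j < m then U $$ (j, i) else 0
     else if j < m then 0 else if i - r = j - m then 1 else 0)"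
  using assms by (auto simp: U'_def Let_def mat_of_cols_def)

text \<open>Moving \<open>V\<close> to the other side of the product leaves a diagonal scaling of
  the coordinates of \<open>a\<close> in the basis of right singular vectors.\<close>

lemma col_B'_scalar_prod:
  assumes U: "U \<in> carrier_mat m m" and V: "V \<in> carrier_mat n n" and r: "r \<le> m" "r \<le> n"
    and a: "a \<in> carrier_vec n" and j: "j < m + n - r"
  shows "col (B' m n r U \<sigma> V) j \<bullet> a =
    (\<Sum>i<n. (transpose_mat V *\<^sub>v a) $ i * ((if i < r then inverse (\<sigma> i) else 1) * U' m n r U $$ (i, j)))"
proof -
  note U' = U'_carrier[OF U r]
  note L = Lambda'_carrier[of n r \<sigma>]
  have "col (B' m n r U \<sigma> V) j = V *\<^sub>v col (Lambda' n r \<sigma> * U' m n r U) j"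
    unfolding B'_def assoc_mult_mat[OF V L U'] using V mult_carrier_mat[OF L U'] j by (rule col_mult2)
  moreover have q: "col (Lambda' n r \<sigma> * U' m n r U) j \<in> carrier_vec n"
    using j mult_carrier_mat[OF L U'] by (rule col_carrier_vec)
  ultimately have "col (B' m n r U \<sigma> V) j \<bullet> a =
      (transpose_mat V *\<^sub>v a) \<bullet> col (Lambda' n r \<sigma> * U' m n r U) j"
    using transpose_vec_mult_scalar[OF V q a] comm_scalar_prod[OF a mult_mat_vec_carrier[OF V q]]
    by (simp only:)
  also have "Lambda' n r \<sigma> * U' m n r U =
      mat n (m + n - r) (\<lambda>(i, j). (if i < r then inverse (\<sigma> i) else 1) * U' m n r U $$ (i, j))"
    unfolding Lambda'_def using U' by (rule mat_diag_mult_left)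
  finally show ?thesis
    using j by (simp add: scalar_prod_def lessThan_atLeast0)
qed

text \<open>For \<open>j < m\<close> these products are the entries of the transposed pseudoinverse
  of \<open>B\<close> applied to \<open>a\<close>.\<close>

lemma col_B'_scalar_prod_lt:
  assumes "U \<in> carrier_mat m m" "V \<in> carrier_mat n n" "r \<le> m" "r \<le> n"
    and "a \<in> carrier_vec n" "j < m"
  shows "col (B' m n r U \<sigma> V) j \<bullet> a =
    (\<Sum>i<r. U $$ (j, i) * (inverse (\<sigma> i) * (transpose_mat V *\<^sub>v a) $ i))"
proof -
  have "col (B' m n r U \<sigma> V) j \<bullet> a =
      (\<Sum>i<n. if i < r then U $$ (j, i) * (inverse (\<sigma> i) * (transpose_mat V *\<^sub>v a) $ i) else 0)"
    using assms by (simp add: col_B'_scalar_prod index_U') (rule sum.cong, auto)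
  also have "\<dots> = (\<Sum>i<r. U $$ (j, i) * (inverse (\<sigma> i) * (transpose_mat V *\<^sub>v a) $ i))"
    using assms by (intro sum.mono_neutral_cong_right) auto
  finally show ?thesis .
qed

text \<open>The columns of \<open>B'\<close> from index \<open>m\<close> on are the columns
  \<open>r, ..., n - 1\<close> of \<open>V\<close>, which \<open>B\<close> maps to zero.\<close>

lemma col_B'_scalar_prod_ge:
  assumes "U \<in> carrier_mat m m" "V \<in> carrier_mat n n" "r \<le> m" "r \<le> n"
    and "a \<in> carrier_vec n" "r \<le> i" "i < n"
  shows "col (B' m n r U \<sigma> V) (m + (i - r)) \<bullet> a = (transpose_mat V *\<^sub>v a) $ i"
proof -
  have j: "m + (i - r) < m + n - r" using assms by simp
  have "col (B' m n r U \<sigma> V) (m + (i - r)) \<bullet> a =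
      (\<Sum>i'<n. if i' = i then (transpose_mat V *\<^sub>v a) $ i else 0)"
    unfolding col_B'_scalar_prod[OF assms(1-5) j]
    using assms j by (intro sum.cong) (auto simp: index_U' simp del: index_mult_mat_vec)
  then show ?thesis using assms by simp
qed

lemma svd_transpose_mult_vec:
  assumes U: "U \<in> carrier_mat m m" and V: "V \<in> carrier_mat n n" and r: "r \<le> m" "r \<le> n"
    and B: "B = U * singular_value_mat m n r \<sigma> * transpose_mat V" and g: "g \<in> carrier_vec m"
  shows "transpose_mat B *\<^sub>v g =
    V *\<^sub>v vec n (\<lambda>i. if i < r then \<sigma> i * (transpose_mat U *\<^sub>v g) $ i else 0)"
proof -
  define S where "S = singular_value_mat m n r \<sigma>"
  have S: "S \<in> carrier_mat m n" by (simp add: S_def singular_value_mat_def)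
  have "transpose_mat S *\<^sub>v h = vec n (\<lambda>i. if i < r then \<sigma> i * h $ i else 0)"
    if h: "h \<in> carrier_vec m" for h
  proof
    fix i assume "i < dim_vec (vec n (\<lambda>i. if i < r then \<sigma> i * h $ i else 0))"
    then have i: "i < n" by simp
    then have "(transpose_mat S *\<^sub>v h) $ i = (\<Sum>j<m. if j = i \<and> i < r then \<sigma> i * h $ i else 0)"
      using h S by (simp add: scalar_prod_def lessThan_atLeast0 S_def singular_value_mat_def)
        (rule sum.cong, auto)
    also have "\<dots> = (if i < r then \<sigma> i * h $ i else 0)"
      using r by (cases "i < r") auto
    finally show "(transpose_mat S *\<^sub>v h) $ i = vec n (\<lambda>i. if i < r then \<sigma> i * h $ i else 0) $ i"
      using i by simp
  qed (use S in simp)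
  moreover have "transpose_mat B = V * (transpose_mat S * transpose_mat U)"
    using U V S unfolding B S_def[symmetric]
    by (simp add: transpose_mult[of _ m n _ n] transpose_mult[of _ m m _ n] del: assoc_mult_mat)
  ultimately show ?thesis
    using U V S g
    by (simp add: assoc_mult_mat_vec[of V n n _ m] assoc_mult_mat_vec[of "transpose_mat S" n m _ m])
qed

text \<open>The range of \<open>B^T\<close> is spanned by the first \<open>r\<close> columns of
  \<open>V\<close>, which are orthogonal to the remaining ones.\<close>

lemma svd_col_B'_scalar_prod_transpose_eq_0:
  assumes svd: "is_svd m n r B U \<sigma> V" and r: "r \<le> m" "r \<le> n"
    and g: "g \<in> carrier_vec m" and j: "m \<le> j" "j < m + n - r"
  shows "col (B' m n r U \<sigma> V) j \<bullet> (transpose_mat B *\<^sub>v g) = 0"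
proof -
  have U: "U \<in> carrier_mat m m" and V: "V \<in> carrier_mat n n" "transpose_mat V * V = 1\<^sub>m n"
    and B: "B = U * singular_value_mat m n r \<sigma> * transpose_mat V"
    using svd by (auto simp: is_svd_def orthonormal_mat_def)
  define i where "i = r + (j - m)"
  have i: "r \<le> i" "i < n" "j = m + (i - r)"
    using j r by (auto simp: i_def)
  define c where "c = vec n (\<lambda>i. if i < r then \<sigma> i * (transpose_mat U *\<^sub>v g) $ i else 0)"
  have c: "c \<in> carrier_vec n" by (simp add: c_def)
  have Btg: "transpose_mat B *\<^sub>v g = V *\<^sub>v c"
    unfolding c_def using U V(1) r B g by (rule svd_transpose_mult_vec)
  have "transpose_mat V *\<^sub>v (V *\<^sub>v c) = c"
    using V c by (simp flip: assoc_mult_mat_vec)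
  then show ?thesis
    unfolding Btg i(3) using U V c r i by (subst col_B'_scalar_prod_ge) (auto simp: c_def)
qed

text \<open>\<open>B^T\<close> composed with its pseudoinverse is the orthogonal projection onto the
  range of \<open>B^T\<close>, and \<open>zero\<close> places \<open>a\<close> in that
  range.\<close>

lemma svd_transpose_mult_col_B'_scalar_prods:
  assumes svd: "is_svd m n r B U \<sigma> V" and r: "r \<le> m" "r \<le> n"
    and a: "a \<in> carrier_vec n"
    and zero: "\<And>j. \<lbrakk>m \<le> j; j < m + n - r\<rbrakk> \<Longrightarrow> col (B' m n r U \<sigma> V) j \<bullet> a = 0"
  shows "transpose_mat B *\<^sub>v vec m (\<lambda>j. col (B' m n r U \<sigma> V) j \<bullet> a) = a"
proof -
  have U: "U \<in> carrier_mat m m" "transpose_mat U * U = 1\<^sub>m m"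
    and V: "V \<in> carrier_mat n n" "V * transpose_mat V = 1\<^sub>m n"
    and B: "B = U * singular_value_mat m n r \<sigma> * transpose_mat V"
    and \<sigma>: "\<And>i. i < r \<Longrightarrow> 0 < \<sigma> i"
    using svd by (auto simp: is_svd_def orthonormal_mat_def)
  define g where "g = vec m (\<lambda>j. col (B' m n r U \<sigma> V) j \<bullet> a)"
  define c where "c = transpose_mat V *\<^sub>v a"
  \<comment> \<open>The coordinates of \<open>g\<close> with respect to the columns of
    \<open>U\<close>, padded by zeros from \<open>r\<close> to \<open>m\<close>; the factors
    \<open>inverse (\<sigma> i)\<close> will cancel against the singular values in
    \<open>B^T\<close>.\<close>
  define d where "d = vec m (\<lambda>i. if i < r then inverse (\<sigma> i) * c $ i else 0)"
  have c: "c \<in> carrier_vec n" using V a by (simp add: c_def)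
  have g: "g \<in> carrier_vec m" and d: "d \<in> carrier_vec m" by (simp_all add: g_def d_def)
  have "g = U *\<^sub>v d"
  proof
    fix j assume "j < dim_vec (U *\<^sub>v d)"
    then have j: "j < m" using U by simp
    then have "(U *\<^sub>v d) $ j = (\<Sum>i<m. U $$ (j, i) * d $ i)"
      using U d by (simp add: scalar_prod_def lessThan_atLeast0)
    also have "\<dots> = (\<Sum>i<r. U $$ (j, i) * (inverse (\<sigma> i) * c $ i))"
      using r by (intro sum.mono_neutral_cong_right) (auto simp: d_def)
    also have "\<dots> = g $ j"
      using U V r a j by (simp add: g_def c_def col_B'_scalar_prod_lt)
    finally show "g $ j = (U *\<^sub>v d) $ j" by simp
  qed (use U g in auto)
  then have Utg: "transpose_mat U *\<^sub>v g = d"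
    using U d by (simp flip: assoc_mult_mat_vec)
  have "transpose_mat B *\<^sub>v g = V *\<^sub>v vec n (\<lambda>i. if i < r then \<sigma> i * d $ i else 0)"
    using svd_transpose_mult_vec[OF U(1) V(1) r B g] unfolding Utg .
  also have "vec n (\<lambda>i. if i < r then \<sigma> i * d $ i else 0) = c"
  proof
    fix i assume "i < dim_vec c"
    then have i: "i < n" using c by simp
    \<comment> \<open>Here the hypothesis \<open>zero\<close> enters: \<open>c\<close> has no
      component along the null space of \<open>B\<close>.\<close>
    have "c $ i = 0" if "r \<le> i"
      using zero[of "m + (i - r)"] col_B'_scalar_prod_ge[OF U(1) V(1) r a that i] that i r
      by (simp add: c_def)
    moreover have "\<sigma> i * (inverse (\<sigma> i) * c $ i) = c $ i" if "i < r"
      using \<sigma>[OF that] by simp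
    ultimately show "vec n (\<lambda>i. if i < r then \<sigma> i * d $ i else 0) $ i = c $ i"
      using i r by (auto simp: d_def)
  qed (use c in simp)
  also have "V *\<^sub>v c = a"
    using V a by (simp add: c_def flip: assoc_mult_mat_vec)
  finally show ?thesis by (simp add: g_def)
qed

section \<open>The characterization of solutions\<close>

theorem theorem4p5:
  fixes m n r l :: nat
    and \<psi> :: "real vec \<Rightarrow> real"
    and B U V :: "real mat"
    and \<sigma> z :: "nat \<Rightarrow> real"
    and k :: "nat \<Rightarrow> nat"
    and lam :: real
    and u :: "real vec"
  assumes "convex_fun_vec n \<psi>"
    and "B \<in> carrier_mat m n"
    and "vec_space.rank m B = r"
    and "0 < r" and "r \<le> min m n"
    and "is_svd m n r B U \<sigma> V"
    and "0 < lam"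
    and "l \<le> m"
    and "u \<in> carrier_vec n"
    and "inj_on k {..<l}" and "k ` {..<l} \<subseteq> {..<m}"
    and "\<forall>i<l. z (k i) \<noteq> 0"
    and "B *\<^sub>v u = finsum_vec TYPE(real) m (\<lambda>i. z (k i) \<cdot>\<^sub>v unit_vec m (k i)) {..<l}"
  shows "is_arg_min (\<lambda>v. \<psi> v + lam * l1_norm_vec (B *\<^sub>v v)) (\<lambda>v. v \<in> carrier_vec n) u \<longleftrightarrow>
    (\<exists>a \<in> subdifferential_vec n \<psi> u. \<exists>b \<in> mat_kernel (transpose_mat B).
      (\<forall>i<l. lam = - (col (B' m n r U \<sigma> V) (k i) \<bullet> a + b $ k i) * sgn (z (k i))) \<and>
      (\<forall>j \<in> {..<m} - k ` {..<l}. lam \<ge> \<bar>col (B' m n r U \<sigma> V) j \<bullet> a + b $ j\<bar>) \<and>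
      (\<forall>j \<in> {..<m + n - r} - {..<m}. col (B' m n r U \<sigma> V) j \<bullet> a = 0))"
proof -
  let ?c = "\<lambda>a j. col (B' m n r U \<sigma> V) j \<bullet> a"
  let ?x = "B *\<^sub>v u"
  note B = assms(2) and svd = assms(6)
  have r: "r \<le> m" "r \<le> n" using assms(5) by auto
  have Bt: "transpose_mat B \<in> carrier_mat n m" using B by simp
  have x: "?x $ j = (\<Sum>i<l. if k i = j then z (k i) else 0)" if "j < m" for j
    using that by (simp add: assms(13) index_finsum_vec unit_vec_def) (rule sum.cong, auto)
  have x_k: "?x $ k i = z (k i)" if i: "i < l" for i
  proof -
    have "?x $ k i = (\<Sum>i'<l. if k i' = k i then z (k i') else 0)"
      using assms(11) i by (intro x) auto
    also have "\<dots> = (\<Sum>i'<l. if i' = i then z (k i) else 0)"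
      using assms(10) i by (intro sum.cong) (auto dest: inj_onD)
    finally show ?thesis using i by simp
  qed
  have x_0: "?x $ j = 0" if "j < m" "j \<notin> k ` {..<l}" for j
    using that by (subst x) (auto intro!: sum.neutral)
  have signs: "(\<forall>y \<in> carrier_vec m. lam * l1_norm_vec ?x - g \<bullet> (y - ?x) \<le> lam * l1_norm_vec y) \<longleftrightarrow>
      (\<forall>i<l. lam = - g $ k i * sgn (z (k i))) \<and> (\<forall>j \<in> {..<m} - k ` {..<l}. lam \<ge> \<bar>g $ j\<bar>)"
    if "g \<in> carrier_vec m" for g
  proof -
    have k: "k i < m" "?x $ k i = z (k i)" "z (k i) \<noteq> 0" if "i < l" for i
      using assms(11,12) x_k that by auto
    have nonzero: "(\<forall>j<m. ?x $ j \<noteq> 0 \<longrightarrow> lam = - g $ j * sgn (?x $ j)) \<longleftrightarrow>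
        (\<forall>i<l. lam = - g $ k i * sgn (z (k i)))" (is "?A \<longleftrightarrow> ?C")
    proof
      assume A: ?A
      show ?C
      proof (intro allI impI)
        fix i assume "i < l"
        with A[rule_format, of "k i"] k show "lam = - g $ k i * sgn (z (k i))" by metis
      qed
    next
      assume C: ?C
      show ?A
      proof (intro allI impI)
        fix j assume "j < m" "?x $ j \<noteq> 0"
        then obtain i where "i < l" "j = k i" using x_0 by blast
        with C k show "lam = - g $ j * sgn (?x $ j)" by metis
      qed
    qed
    have "{..<m} - k ` {..<l} = {j. j < m \<and> ?x $ j = 0}"
      using x_0 k by (fastforce simp del: index_mult_mat_vec)
    then have zero: "(\<forall>j<m. ?x $ j = 0 \<longrightarrow> \<bar>g $ j\<bar> \<le> lam) \<longleftrightarrow>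
        (\<forall>j \<in> {..<m} - k ` {..<l}. lam \<ge> \<bar>g $ j\<bar>)"
      by blast
    have "?x \<in> carrier_vec m" using B assms(9) by simp
    then show ?thesis
      unfolding nonzero[symmetric] zero[symmetric]
      using that assms(7) by (intro l1_norm_vec_subgradient_iff) auto
  qed
  have k: "k i < m" if "i < l" for i
    using assms(11) that by auto
  note min_iff = arg_min_l1_composite_iff[OF assms(1) B assms(9) less_imp_le[OF assms(7)]]
  show ?thesis (is "?min \<longleftrightarrow> ?R")
  proof
    assume ?min
    then obtain g where g: "g \<in> carrier_vec m" and sub: "transpose_mat B *\<^sub>v g \<in> subdifferential_vec n \<psi> u"
      and sgns: "\<forall>i<l. lam = - g $ k i * sgn (z (k i))"
        "\<forall>j \<in> {..<m} - k ` {..<l}. lam \<ge> \<bar>g $ j\<bar>"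
      unfolding min_iff using signs by blast
    define a where "a = transpose_mat B *\<^sub>v g"
    have a: "a \<in> carrier_vec n" using Bt g by (simp add: a_def)
    \<comment> \<open>\<open>h\<close> and \<open>g\<close> have the same image \<open>a\<close>
      under \<open>B^T\<close>, so \<open>b = g - h\<close> lies in the kernel and restores
      \<open>g\<close> from the products with the columns of \<open>B'\<close>.\<close>
    define h where "h = vec m (?c a)"
    have h: "h \<in> carrier_vec m" by (simp add: h_def)
    have zero: "?c a j = 0" if "m \<le> j" "j < m + n - r" for j
      unfolding a_def using svd r g that by (rule svd_col_B'_scalar_prod_transpose_eq_0)
    then have "transpose_mat B *\<^sub>v h = a"
      unfolding h_def using svd r a by (intro svd_transpose_mult_col_B'_scalar_prods)
    then have "transpose_mat B *\<^sub>v (g - h) = 0\<^sub>v n"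
      using a by (simp add: mult_minus_distrib_mat_vec[OF Bt g h] flip: a_def)
    then have "g - h \<in> mat_kernel (transpose_mat B)"
      using g h by (intro mat_kernelI[OF Bt]) auto
    moreover have gh: "?c a j + (g - h) $ j = g $ j" if "j < m" for j
      using that g by (simp add: h_def)
    have "\<forall>i<l. lam = - (?c a (k i) + (g - h) $ k i) * sgn (z (k i))"
      using sgns(1) gh k by simp
    moreover have "\<forall>j \<in> {..<m} - k ` {..<l}. lam \<ge> \<bar>?c a j + (g - h) $ j\<bar>"
      using sgns(2) gh by simp
    moreover have "\<forall>j \<in> {..<m + n - r} - {..<m}. ?c a j = 0"
      using zero by simp
    ultimately show ?R
      using sub unfolding a_def[symmetric] by blast
  next
    assume ?R
    then obtain a b where a: "a \<in> subdifferential_vec n \<psi> u" and b: "b \<in> mat_kernel (transpose_mat B)"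
      and sgns: "\<forall>i<l. lam = - (?c a (k i) + b $ k i) * sgn (z (k i))"
        "\<forall>j \<in> {..<m} - k ` {..<l}. lam \<ge> \<bar>?c a j + b $ j\<bar>"
      and zero: "\<forall>j \<in> {..<m + n - r} - {..<m}. ?c a j = 0"
      by blast
    have a': "a \<in> carrier_vec n" using a by (simp add: subdifferential_vec_def)
    note b' = mat_kernelD[OF Bt b]
    \<comment> \<open>Conversely the multiplier is \<open>g = h + b\<close>: \<open>h\<close> is a
      preimage of \<open>a\<close> under \<open>B^T\<close>, and adding \<open>b\<close> keeps that
      image.\<close>
    define h where "h = vec m (?c a)"
    have h: "h \<in> carrier_vec m" by (simp add: h_def)
    have "transpose_mat B *\<^sub>v h = a"
      unfolding h_def using svd r a' zero by (intro svd_transpose_mult_col_B'_scalar_prods) auto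
    then have Bhb: "transpose_mat B *\<^sub>v (h + b) = a"
      using b' a' by (simp add: mult_add_distrib_mat_vec[OF Bt h])
    have hb: "?c a j + b $ j = (h + b) $ j" if "j < m" for j
      using that b'(1) by (simp add: h_def)
    have "\<forall>i<l. lam = - (h + b) $ k i * sgn (z (k i))"
      using sgns(1) hb k by metis
    moreover have "\<forall>j \<in> {..<m} - k ` {..<l}. lam \<ge> \<bar>(h + b) $ j\<bar>"
      using sgns(2) hb by simp
    moreover have hb_carrier: "h + b \<in> carrier_vec m" using h b'(1) by simp
    ultimately have "\<forall>y \<in> carrier_vec m.
        lam * l1_norm_vec ?x - (h + b) \<bullet> (y - ?x) \<le> lam * l1_norm_vec y"
      using signs by blast
    then show ?min
      using hb_carrier a unfolding Bhb[symmetric] min_iff by blast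
  qed
qed

end
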